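(* For every real $s>1$, $$\limsup_{n\to\infty}\frac{\varrho_s(n)\sigma_s(n)}{n^{2s}}=\frac{\zeta(s)}{\zeta(2s)}.$$
   Context: $d\,\|\,n$ means that $d$ is a unitary divisor of $n$, i.e. $d\ge1$, $d\mid n$ and $\gcd(d,n/d)=1$. For a real number $s$, $\phi_s(n)=\sum_{d\mid n}d^s\mu(n/d)$ ($\mu$ is the Möbius function), $\varrho_s(n)=\sum_{d\,\|\,n}\phi_s(d)$, and $\sigma_s(n)=\sum_{d\mid n}d^s$. $\zeta$ is the Riemann zeta function. *)

theory Defs
  imports
    "HOL-Analysis.Analysis"
    "HOL-Computational_Algebra.Squarefree"
begin

definition moebius_mu :: "nat \<Rightarrow> int" where
  "moebius_mu n = (if squarefree n then (- 1) ^ card (prime_factors n) else 0)"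

definition unitary_dvd :: "nat \<Rightarrow> nat \<Rightarrow> bool" where
  "unitary_dvd d n \<longleftrightarrow> d \<ge> 1 \<and> d dvd n \<and> gcd d (n div d) = 1"

(* The arithmetic functions below are meaningful for n >= 1 only; the divisors of 0
   form an infinite set. *)

definition phi_s :: "real \<Rightarrow> nat \<Rightarrow> real" where
  "phi_s s n = (\<Sum>d | d dvd n. real d powr s * of_int (moebius_mu (n div d)))"

definition rho_s :: "real \<Rightarrow> nat \<Rightarrow> real" where
  "rho_s s n = (\<Sum>d | unitary_dvd d n. phi_s s d)"

definition sigma_s :: "real \<Rightarrow> nat \<Rightarrow> real" where
  "sigma_s s n = (\<Sum>d | d dvd n. real d powr s)"

(* The Riemann zeta function restricted to real arguments s > 1, where it is given by
   its absolutely convergent Dirichlet series; no meaning is intended for s <= 1. *)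

definition riemann_zeta :: "real \<Rightarrow> real" where
  "riemann_zeta s = (\<Sum>n. 1 / real (Suc n) powr s)"

lemma riemann_zeta_sums:
  assumes "s > 1"
  shows "(\<lambda>n. 1 / real (Suc n) powr s) sums riemann_zeta s"
proof -
  have "summable (\<lambda>n. real n powr (- s))"
    using assms by (simp add: summable_real_powr_iff)
  hence "summable (\<lambda>n. real (Suc n) powr (- s))"
    by (subst summable_Suc_iff)
  hence "summable (\<lambda>n. 1 / real (Suc n) powr s)"
    by (simp only: powr_minus_divide)
  thus ?thesis
    unfolding riemann_zeta_def by (rule summable_sums)
qed

end

theory Submission
  imports Defs
begin

text \<open>
  The quotient is a multiplicative function of \<open>n\<close>. Its value at a prime power
  \<open>p ^ a\<close> with \<open>a \<ge> 1\<close> is at most \<open>1 + p powr (- s)\<close>, with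
  equality for \<open>a = 1\<close>. Multiplied out over a finite set \<open>A\<close> of primes, these
  bounds give \<open>\<Sum>d | d dvd \<Prod>A. d powr (- s)\<close>, a partial sum of the series
  of \<open>d powr (- s)\<close> over the squarefree numbers, and every finite set of squarefree
  numbers is covered by such a partial sum. Writing \<open>n = d * m\<^sup>2\<close> with \<open>d\<close> squarefree
  shows that this series has the value \<open>\<zeta>(s) / \<zeta>(2s)\<close>.
\<close>

section \<open>Multiplicativity of divisor sums\<close>

text \<open>Every divisor of \<open>m * n\<close> splits uniquely into a divisor of \<open>m\<close>
  and one of \<open>n\<close>, and the codivisor splits along with it. Letting \<open>F\<close> see
  both the divisor and the codivisor covers three cases at once: plain divisor sums, Dirichlet
  convolutions, and unitary sums, where coprimality of the two arguments enters as an
  indicator.\<close>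

lemma sum_divisors_mult_coprime:
  fixes F :: "nat \<Rightarrow> nat \<Rightarrow> real"
  assumes "coprime m n" "m > 0" "n > 0"
    and F: "\<And>a a' b b'. \<lbrakk>a > 0; a' > 0; b > 0; b' > 0; coprime (a * a') (b * b')\<rbrakk>
      \<Longrightarrow> F (a * b) (a' * b') = F a a' * F b b'"
  shows "(\<Sum>d | d dvd m * n. F d (m * n div d))
         = (\<Sum>d | d dvd m. F d (m div d)) * (\<Sum>d | d dvd n. F d (n div d))"
proof -
  have eq: "F (a * b) (m * n div (a * b)) = F a (m div a) * F b (n div b)"
    if "a dvd m" "b dvd n" for a b
  proof -
    from that obtain a' b' where ab: "m = a * a'" "n = b * b'" by (auto elim!: dvdE)
    with assms have pos: "a > 0" "a' > 0" "b > 0" "b' > 0" by auto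
    have "m * n = (a * b) * (a' * b')" using ab by simp
    then have "m * n div (a * b) = a' * b'" using pos by simp
    then show ?thesis using F[OF pos] assms(1) ab pos by simp
  qed
  have "(\<Sum>d | d dvd m. F d (m div d)) * (\<Sum>d | d dvd n. F d (n div d))
      = (\<Sum>(a,b)\<in>{d. d dvd m} \<times> {d. d dvd n}. F a (m div a) * F b (n div b))"
    by (simp add: sum_product sum.cartesian_product)
  also have "\<dots> = (\<Sum>d | d dvd m * n. F d (m * n div d))"
  \<comment> \<open>The inverse of \<open>(a, b)\<close> going to \<open>a * b\<close> takes the gcd
    with \<open>m\<close> and with \<open>n\<close>; coprimality of \<open>m\<close> and
    \<open>n\<close> makes these two maps mutually inverse.\<close>
  proof (rule sum.reindex_bij_witness[where i = "\<lambda>d. (gcd d m, gcd d n)" and j = "\<lambda>(a,b). a * b"])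
    fix p assume p: "p \<in> {d. d dvd m} \<times> {d. d dvd n}"
    obtain a b where [simp]: "p = (a, b)" by (cases p)
    from p have ab: "a dvd m" "b dvd n" by auto
    have "coprime b m" "coprime a n"
      using ab assms(1) by (meson coprime_commute coprime_divisors dvd_refl)+
    then have "gcd (a * b) m = a" "gcd (a * b) n = b"
      using ab by (simp_all add: gcd_mult_right_right_cancel gcd_mult_right_left_cancel
          gcd_mult_left_right_cancel gcd_mult_left_left_cancel gcd_nat.absorb1 coprime_commute)
    then show "(case p of (a, b) \<Rightarrow> a * b) \<in> {d. d dvd m * n}"
      "(gcd (case p of (a, b) \<Rightarrow> a * b) m, gcd (case p of (a, b) \<Rightarrow> a * b) n) = p"
      using ab by (auto simp: mult_dvd_mono)
    show "F (case p of (a, b) \<Rightarrow> a * b) (m * n div (case p of (a, b) \<Rightarrow> a * b))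
        = (case p of (a, b) \<Rightarrow> F a (m div a) * F b (n div b))"
      using eq[OF ab] by simp
  next
    fix d assume d: "d \<in> {d. d dvd m * n}"
    then obtain a b where "d = a * b" "a dvd m" "b dvd n"
      using division_decomp[of d m n] by auto
    then have "d dvd gcd d m * gcd d n" by (simp add: mult_dvd_mono)
    moreover have "gcd d m * gcd d n dvd d"
      using assms(1) by (intro divides_mult) (auto intro: coprime_divisors[of _ m _ n])
    ultimately show "(case (gcd d m, gcd d n) of (a, b) \<Rightarrow> a * b) = d"
      by (simp add: dvd_antisym)
    show "(gcd d m, gcd d n) \<in> {d. d dvd m} \<times> {d. d dvd n}" by simp
  qed
  finally show ?thesis by simp
qed

text \<open>The exponents are left free because two choices are needed: the multiplicities of an
  arbitrary \<open>n\<close>, and the constant 1 for squarefree products of primes.\<close>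

lemma prod_multiplicative_primepow:
  fixes h :: "nat \<Rightarrow> real"
  assumes "h 1 = 1"
    and mult: "\<And>m n. \<lbrakk>coprime m n; m > 0; n > 0\<rbrakk> \<Longrightarrow> h (m * n) = h m * h n"
    and "finite A" "\<And>p. p \<in> A \<Longrightarrow> prime p"
  shows "h (\<Prod>p\<in>A. p ^ e p) = (\<Prod>p\<in>A. h (p ^ e p))"
  using assms(3,4)
proof (induction A)
  case empty
  then show ?case using assms(1) by simp
next
  case (insert q A)
  have "coprime (q ^ e q) (\<Prod>p\<in>A. p ^ e p)"
    using insert.hyps insert.prems by (intro prod_coprime_right) (auto intro!: primes_coprime)
  moreover have "q ^ e q > 0" "(\<Prod>p\<in>A. p ^ e p) > 0"
    using insert.prems by (auto intro!: prod_pos simp: prime_gt_0_nat)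
  ultimately show ?case using insert mult by simp
qed

lemma moebius_mu_mult_coprime:
  assumes "coprime m n" "m > 0" "n > 0"
  shows "moebius_mu (m * n) = moebius_mu m * moebius_mu n"
proof (cases "squarefree m \<and> squarefree n")
  case True
  have "prime_factors m \<inter> prime_factors n = {}"
    using assms(1) by (metis disjoint_iff in_prime_factors_iff coprime_common_divisor not_prime_unit)
  moreover have "prime_factors (m * n) = prime_factors m \<union> prime_factors n"
    using assms by (intro prime_factors_product) auto
  ultimately have "card (prime_factors (m * n)) = card (prime_factors m) + card (prime_factors n)"
    by (simp add: card_Un_disjoint)
  with True assms(1) show ?thesis
    by (simp add: moebius_mu_def squarefree_mult_coprime power_add)
next
  case False
  then have "\<not> squarefree (m * n)" by (auto dest: squarefree_multD)
  with False show ?thesis by (auto simp: moebius_mu_def)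
qed

lemma moebius_mu_primepow:
  assumes "prime p"
  shows "moebius_mu (p ^ i) = (if i = 0 then 1 else if i = 1 then - 1 else 0)"
  using assms
  by (auto simp: moebius_mu_def squarefree_power_iff squarefree_prime prime_factorization_prime)

lemma sigma_s_mult_coprime:
  assumes "coprime m n" "m > 0" "n > 0"
  shows "sigma_s s (m * n) = sigma_s s m * sigma_s s n"
  using sum_divisors_mult_coprime[OF assms, where F = "\<lambda>d _. real d powr s"]
  by (simp add: sigma_s_def powr_mult)

lemma phi_s_mult_coprime:
  assumes "coprime m n" "m > 0" "n > 0"
  shows "phi_s s (m * n) = phi_s s m * phi_s s n"
  unfolding phi_s_def
  by (rule sum_divisors_mult_coprime[OF assms, where F = "\<lambda>d e. real d powr s * of_int (moebius_mu e)"])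
     (simp add: powr_mult moebius_mu_mult_coprime)

text \<open>Turning the unitary condition into an indicator lets the sum run over all divisors, the
  shape to which \<open>sum_divisors_mult_coprime\<close> and \<open>sum_divisors_primepow\<close>
  apply.\<close>

lemma rho_s_eq_sum_divisors:
  assumes "n > 0"
  shows "rho_s s n = (\<Sum>d | d dvd n. if coprime d (n div d) then phi_s s d else 0)"
proof -
  have "{d. unitary_dvd d n} = {d \<in> {d. d dvd n}. coprime d (n div d)}"
    using assms by (auto simp: unitary_dvd_def coprime_iff_gcd_eq_1 Suc_le_eq intro: Nat.gr0I)
  then show ?thesis
    using assms by (simp only: rho_s_def sum.inter_filter[of "{d. d dvd n}", OF finite_divisors_nat])
qed

lemma rho_s_mult_coprime:
  assumes "coprime m n" "m > 0" "n > 0"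
  shows "rho_s s (m * n) = rho_s s m * rho_s s n"
proof -
  have "(\<Sum>d | d dvd m * n. if coprime d (m * n div d) then phi_s s d else 0)
      = (\<Sum>d | d dvd m. if coprime d (m div d) then phi_s s d else 0)
        * (\<Sum>d | d dvd n. if coprime d (n div d) then phi_s s d else 0)"
    by (rule sum_divisors_mult_coprime[OF assms,
          where F = "\<lambda>d e. if coprime d e then phi_s s d else 0"])
       (auto simp: phi_s_mult_coprime coprime_commute)
  then show ?thesis using assms by (simp add: rho_s_eq_sum_divisors)
qed

section \<open>Values at prime powers\<close>

lemma sum_divisors_primepow:
  assumes "prime (p :: nat)"
  shows "(\<Sum>d | d dvd p ^ k. f d) = (\<Sum>i\<le>k. f (p ^ i))"
proof -
  have "{d. d dvd p ^ k} = (\<lambda>i. p ^ i) ` {..k}"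
    using divides_primepow_nat[OF assms] by auto
  moreover have "inj_on (\<lambda>i. p ^ i) {..k}"
    using prime_gt_1_nat[OF assms] by (auto simp: inj_on_def)
  ultimately show ?thesis by (simp add: sum.reindex)
qed

lemma powr_power_base: "real (p ^ i) powr s = (real p powr s) ^ i" for p i :: nat
  by (induction i) (auto simp: powr_mult)

lemma sigma_s_primepow:
  assumes "prime p"
  shows "sigma_s s (p ^ k) = (\<Sum>i\<le>k. (real p powr s) ^ i)"
  using assms by (simp add: sigma_s_def sum_divisors_primepow powr_power_base del: of_nat_power)

lemma phi_s_1: "phi_s s 1 = 1"
  by (simp add: phi_s_def moebius_mu_def)

lemma phi_s_primepow:
  assumes "prime p"
  shows "phi_s s (p ^ Suc b) = (real p powr s) ^ Suc b - (real p powr s) ^ b"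
proof -
  let ?y = "real p powr s"
  have "phi_s s (p ^ Suc b) = (\<Sum>i\<le>Suc b. ?y ^ i * of_int (moebius_mu (p ^ Suc b div p ^ i)))"
    unfolding phi_s_def by (simp only: sum_divisors_primepow[OF assms] powr_power_base)
  \<comment> \<open>The codivisor is \<open>p ^ (Suc b - i)\<close>, and the Moebius function
    vanishes on it unless the exponent is 0 or 1.\<close>
  also have "\<dots> = (\<Sum>i\<le>Suc b. if i = Suc b then ?y ^ Suc b else if i = b then - (?y ^ b) else 0)"
  proof (rule sum.cong)
    fix i assume "i \<in> {..Suc b}"
    then have "p ^ Suc b div p ^ i = p ^ (Suc b - i)"
      using prime_gt_0_nat[OF assms] by (intro power_diff[symmetric]) auto
    then show "?y ^ i * of_int (moebius_mu (p ^ Suc b div p ^ i))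
        = (if i = Suc b then ?y ^ Suc b else if i = b then - (?y ^ b) else 0)"
      using \<open>i \<in> {..Suc b}\<close> by (simp only: moebius_mu_primepow[OF assms]) auto
  qed simp
  also have "\<dots> = ?y ^ Suc b - ?y ^ b"
    by simp
  finally show ?thesis .
qed

text \<open>Powers of \<open>p\<close> are coprime only if one of them is 1, so just the two extreme
  divisors are unitary; they contribute 1 and \<open>phi_s s (p ^ Suc b)\<close>.\<close>

lemma rho_s_primepow:
  assumes "prime p"
  shows "rho_s s (p ^ Suc b) = 1 + (real p powr s) ^ Suc b - (real p powr s) ^ b"
proof -
  let ?y = "real p powr s"
  have "rho_s s (p ^ Suc b)
      = (\<Sum>i\<le>Suc b. if coprime (p ^ i) (p ^ Suc b div p ^ i) then phi_s s (p ^ i) else 0)"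
    using prime_gt_0_nat[OF assms] by (simp only: rho_s_eq_sum_divisors sum_divisors_primepow[OF assms] zero_less_power)
  also have "\<dots> = (\<Sum>i\<le>Suc b. if i = 0 then 1 else if i = Suc b then phi_s s (p ^ Suc b) else 0)"
  proof (rule sum.cong)
    fix i assume i: "i \<in> {..Suc b}"
    then have "p ^ Suc b div p ^ i = p ^ (Suc b - i)"
      using prime_gt_0_nat[OF assms] by (intro power_diff[symmetric]) auto
    moreover have "coprime (p ^ i) (p ^ (Suc b - i)) \<longleftrightarrow> i = 0 \<or> i = Suc b"
      using i assms by auto
    ultimately show "(if coprime (p ^ i) (p ^ Suc b div p ^ i) then phi_s s (p ^ i) else 0)
        = (if i = 0 then 1 else if i = Suc b then phi_s s (p ^ Suc b) else 0)"
      using phi_s_1 by auto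
  qed simp
  also have "\<dots> = (\<Sum>i\<in>{0, Suc b}. if i = 0 then 1 else if i = Suc b then phi_s s (p ^ Suc b) else 0)"
    by (rule sum.mono_neutral_right) auto
  also have "\<dots> = 1 + phi_s s (p ^ Suc b)" by simp
  finally show ?thesis using phi_s_primepow[OF assms] by simp
qed

section \<open>The quotient and its local bounds\<close>

definition rho_sigma_quotient :: "real \<Rightarrow> nat \<Rightarrow> real" where
  "rho_sigma_quotient s n = rho_s s n * sigma_s s n / real n powr (2 * s)"

lemma rho_sigma_quotient_1: "rho_sigma_quotient s 1 = 1"
  by (simp add: rho_sigma_quotient_def rho_s_eq_sum_divisors sigma_s_def phi_s_1[simplified])

lemma rho_sigma_quotient_mult_coprime:
  assumes "coprime m n" "m > 0" "n > 0"
  shows "rho_sigma_quotient s (m * n) = rho_sigma_quotient s m * rho_sigma_quotient s n"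
  by (simp add: rho_sigma_quotient_def rho_s_mult_coprime[OF assms] sigma_s_mult_coprime[OF assms]
      powr_mult)

lemma rho_sigma_quotient_primepow:
  assumes "prime p"
  shows "rho_sigma_quotient s (p ^ Suc b) =
    (1 + (real p powr s) ^ Suc b - (real p powr s) ^ b) * (\<Sum>i\<le>Suc b. (real p powr s) ^ i)
      / (real p powr s) ^ (2 * Suc b)"
proof -
  have "real (p ^ Suc b) powr (2 * s) = (real (p ^ Suc b) powr s) ^ 2"
    by (simp only: mult_2 powr_add power2_eq_square)
  also have "\<dots> = (real p powr s) ^ (2 * Suc b)"
    by (simp only: powr_power_base power_mult[symmetric] mult.commute[of 2])
  finally show ?thesis
    by (simp only: rho_sigma_quotient_def rho_s_primepow[OF assms] sigma_s_primepow[OF assms])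
qed

lemma rho_sigma_quotient_prime:
  assumes "prime p"
  shows "rho_sigma_quotient s p = 1 + real p powr (- s)"
proof -
  let ?y = "real p powr s"
  have "rho_sigma_quotient s p = (?y * (1 + ?y)) / (?y * ?y)"
    using rho_sigma_quotient_primepow[OF assms, of s 0] by (simp add: power2_eq_square)
  also have "\<dots> = 1 + inverse ?y"
    using prime_gt_0_nat[OF assms] by (simp add: field_simps)
  finally show ?thesis by (simp add: powr_minus)
qed

text \<open>With \<open>y = p powr s\<close> and \<open>w = y ^ b\<close>, clearing denominators
  leaves a difference of the two sides that factors as
  \<open>(w - 1) * (w * (y * (y - 1)) - 1)\<close>. Both factors are nonnegative because
  \<open>y\<close> is at least 2 and \<open>w\<close> at least 1.\<close>

lemma rho_sigma_quotient_primepow_le: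
  assumes "prime p" "s > 1"
  shows "rho_sigma_quotient s (p ^ Suc b) \<le> 1 + real p powr (- s)"
proof -
  define y where "y = real p powr s"
  define w where "w = y ^ b"
  have "(2::real) \<le> real p" using prime_ge_2_nat[OF assms(1)] by simp
  also have "real p = real p powr 1" using \<open>2 \<le> real p\<close> by simp
  also have "\<dots> \<le> y" unfolding y_def using \<open>2 \<le> real p\<close> assms(2) by (intro powr_mono) auto
  finally have y: "y \<ge> 2" .
  then have w: "w \<ge> 1" unfolding w_def by simp
  have "1 * 1 \<le> y * (y - 1)" using y by (intro mult_mono) auto
  then have "1 * 1 \<le> w * (y * (y - 1))" using w by (intro mult_mono) auto
  then have "0 \<le> (w - 1) * (w * (y * (y - 1)) - 1)" using w by simp
  then have "(1 + w * y - w) * (w * y * y - 1) \<le> (w\<^sup>2 * y\<^sup>2 + w\<^sup>2 * y) * (y - 1)"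
    by (simp add: algebra_simps power2_eq_square)
  \<comment> \<open>The geometric sum in closed form; \<open>w * y * y\<close> stands for the power
    of \<open>y\<close> with exponent \<open>b + 2\<close>.\<close>
  moreover have "(\<Sum>i\<le>Suc b. y ^ i) = (w * y * y - 1) / (y - 1)"
    using y unfolding sum_gp0 by (simp add: w_def divide_simps) (simp add: algebra_simps)
  ultimately have "(1 + y ^ Suc b - y ^ b) * (\<Sum>i\<le>Suc b. y ^ i) \<le> w\<^sup>2 * y\<^sup>2 + w\<^sup>2 * y"
    using y by (simp add: w_def[symmetric] divide_le_eq mult.commute)
  also have "\<dots> = (1 + inverse y) * y ^ (2 * Suc b)"
    using y by (simp only: mult_2 power_add power_Suc flip: w_def)
      (simp add: field_simps power2_eq_square)
  finally show ?thesis
    using y by (simp add: rho_sigma_quotient_primepow[OF assms(1)] powr_minus pos_divide_le_eq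
        flip: y_def del: power_Suc sum.atMost_Suc)
qed

section \<open>Products over finite sets of primes\<close>

text \<open>A finite Euler product: each factor is \<open>sigma_s (- s) p\<close>, and
  multiplicativity assembles them. It turns products of local bounds into sums over divisors of a
  squarefree number.\<close>

lemma prod_primes_eq_sigma_s:
  assumes "finite A" "\<And>p. p \<in> A \<Longrightarrow> prime p"
  shows "(\<Prod>p\<in>A. 1 + real p powr (- s)) = sigma_s (- s) (\<Prod>A)"
proof -
  have "sigma_s (- s) (\<Prod>A) = (\<Prod>p\<in>A. sigma_s (- s) p)"
    using prod_multiplicative_primepow[of "sigma_s (- s)" A "\<lambda>_. 1"] assms
    by (simp add: sigma_s_mult_coprime) (simp add: sigma_s_def)
  also have "\<dots> = (\<Prod>p\<in>A. 1 + real p powr (- s))"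
    using sigma_s_primepow[of _ "- s" 1] assms(2) by (intro prod.cong) auto
  finally show ?thesis ..
qed

lemma squarefree_prod_primes:
  assumes "\<And>p. p \<in> A \<Longrightarrow> prime (p::nat)"
  shows "squarefree (\<Prod>A)"
  using assms by (intro squarefree_prod_coprime) (auto intro: primes_coprime squarefree_prime)

lemma squarefree_eq_prod_prime_factors:
  assumes "squarefree (n::nat)"
  shows "n = \<Prod>(prime_factors n)"
proof -
  have n: "n \<noteq> 0" using assms by (intro notI) simp
  have "n = (\<Prod>p\<in>prime_factors n. p ^ multiplicity p n)"
    using prime_factorization_nat n by simp
  also have "\<dots> = \<Prod>(prime_factors n)"
    using assms n by (intro prod.cong) (auto simp: squarefree_factorial_semiring')
  finally show ?thesis .
qed

text \<open>Nonnegativity is what allows the local upper bounds to be multiplied.\<close>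

lemma rho_sigma_quotient_primepow_nonneg:
  assumes "prime p" "s > 1"
  shows "rho_sigma_quotient s (p ^ Suc b) \<ge> 0"
proof -
  have "1 \<le> real p powr s"
    using prime_ge_1_nat[OF assms(1)] assms(2) by (intro ge_one_powr_ge_zero) auto
  then have "(real p powr s) ^ b \<le> (real p powr s) ^ Suc b"
    by (intro power_increasing) auto
  then show ?thesis unfolding rho_sigma_quotient_primepow[OF assms(1)]
    by (intro divide_nonneg_nonneg mult_nonneg_nonneg sum_nonneg) auto
qed

lemma rho_sigma_quotient_le_sigma_s:
  assumes "n > 0" "s > 1"
  shows "rho_sigma_quotient s n \<le> sigma_s (- s) (\<Prod>(prime_factors n))"
proof -
  \<comment> \<open>Prime factors have positive multiplicity, so the local bounds, stated for
    exponents \<open>Suc b\<close>, apply.\<close>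
  have Suc: "multiplicity p n = Suc (multiplicity p n - 1)" if "p \<in> prime_factors n" for p
    using that by (simp add: prime_factors_multiplicity)
  have "rho_sigma_quotient s n = rho_sigma_quotient s (\<Prod>p\<in>prime_factors n. p ^ multiplicity p n)"
    using prime_factorization_nat assms by simp
  also have "\<dots> = (\<Prod>p\<in>prime_factors n. rho_sigma_quotient s (p ^ multiplicity p n))"
    by (rule prod_multiplicative_primepow)
       (auto simp: rho_sigma_quotient_1[simplified] rho_sigma_quotient_mult_coprime)
  also have "\<dots> \<le> (\<Prod>p\<in>prime_factors n. 1 + real p powr (- s))"
  proof (rule prod_mono, intro conjI)
    fix p assume p: "p \<in> prime_factors n"
    then have "prime p" by auto
    show "0 \<le> rho_sigma_quotient s (p ^ multiplicity p n)"
      using rho_sigma_quotient_primepow_nonneg[OF \<open>prime p\<close> assms(2)] Suc[OF p] by metis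
    show "rho_sigma_quotient s (p ^ multiplicity p n) \<le> 1 + real p powr (- s)"
      using rho_sigma_quotient_primepow_le[OF \<open>prime p\<close> assms(2)] Suc[OF p] by metis
  qed
  also have "\<dots> = sigma_s (- s) (\<Prod>(prime_factors n))"
    by (rule prod_primes_eq_sigma_s) auto
  finally show ?thesis .
qed

lemma rho_sigma_quotient_prod_primes:
  assumes "finite A" "\<And>p. p \<in> A \<Longrightarrow> prime p"
  shows "rho_sigma_quotient s (\<Prod>A) = sigma_s (- s) (\<Prod>A)"
proof -
  have "rho_sigma_quotient s (\<Prod>A) = (\<Prod>p\<in>A. rho_sigma_quotient s p)"
    using prod_multiplicative_primepow[of "rho_sigma_quotient s" A "\<lambda>_. 1"] assms
    by (simp add: rho_sigma_quotient_mult_coprime rho_sigma_quotient_1[simplified])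
  also have "\<dots> = (\<Prod>p\<in>A. 1 + real p powr (- s))"
    using assms(2) by (intro prod.cong refl rho_sigma_quotient_prime)
  finally show ?thesis using prod_primes_eq_sigma_s[OF assms] by simp
qed

section \<open>The Dirichlet series over the squarefree numbers\<close>

text \<open>Passing to unordered sums permits restriction to squarefree indices, reindexing by pairs
  and comparison with arbitrary finite partial sums.\<close>

lemma has_sum_riemann_zeta:
  assumes "s > 1"
  shows "((\<lambda>n::nat. real n powr (- s)) has_sum riemann_zeta s) {0<..}"
proof -
  have "((\<lambda>n. 1 / real (Suc n) powr s) has_sum riemann_zeta s) UNIV"
    using riemann_zeta_sums[OF assms] by (intro norm_summable_imp_has_sum) (auto simp: sums_iff)
  also have "?this \<longleftrightarrow> ?thesis"
    by (rule has_sum_reindex_bij_witness[of _ "\<lambda>n. n - 1" Suc]) (auto simp: powr_minus_divide)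
  finally show ?thesis .
qed

lemma riemann_zeta_pos:
  assumes "s > 1"
  shows "riemann_zeta s > 0"
  using finite_sum_le_has_sum[OF has_sum_riemann_zeta[OF assms], of "{1}"] by auto

text \<open>At each prime the exponent of \<open>d * m\<^sup>2\<close> is twice that of
  \<open>m\<close> plus 0 or 1, so halving and rounding down recovers \<open>m\<close>. This gives
  uniqueness of the decomposition into a squarefree number times a square.\<close>

lemma square_part_squarefree_mult_square:
  assumes "squarefree d" "m > 0"
  shows "square_part (d * m\<^sup>2) = (m::nat)"
proof (rule multiplicity_eq_nat)
  have d: "d \<noteq> 0" using assms by (intro notI) simp
  then show "square_part (d * m\<^sup>2) > 0" using assms by (intro Nat.gr0I) simp
  fix p :: nat assume p: "prime p"
  have "multiplicity p d \<le> 1"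
    using assms(1) p d by (simp add: squarefree_factorial_semiring'')
  moreover have "multiplicity p (d * m\<^sup>2) = multiplicity p d + 2 * multiplicity p m"
    using d assms p by (simp add: prime_elem_multiplicity_mult_distrib prime_elem_multiplicity_power_distrib)
  ultimately show "multiplicity p (square_part (d * m\<^sup>2)) = multiplicity p m"
    using p by (simp add: prime_multiplicity_square_part)
qed (use assms in auto)

lemma has_sum_squarefree_powr:
  assumes "s > 1"
  shows "((\<lambda>d. real d powr (- s)) has_sum (riemann_zeta s / riemann_zeta (2 * s)))
           {d. squarefree d}"
proof -
  let ?Q = "{d::nat. squarefree d}" and ?z = "riemann_zeta (2 * s)"
  let ?f = "\<lambda>(d::nat, m::nat). real d powr (- s) * real m powr (- (2 * s))"
  have "?Q \<subseteq> {0<..}" by (auto intro: Nat.gr0I)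
  then have "(\<lambda>d. real d powr (- s)) summable_on ?Q"
    using has_sum_imp_summable[OF has_sum_riemann_zeta[OF assms]]
    by (rule summable_on_subset_banach[rotated])
  then obtain S where S: "((\<lambda>d. real d powr (- s)) has_sum S) ?Q"
    using summable_iff_has_sum_infsum by blast
  have inner: "((\<lambda>m. ?f (d, m)) has_sum real d powr (- s) * ?z) {0<..}" for d
    using has_sum_riemann_zeta[of "2 * s"] assms by (auto intro: has_sum_cmult_right)
  have outer: "((\<lambda>d. real d powr (- s) * ?z) has_sum S * ?z) ?Q"
    using S by (rule has_sum_cmult_left)
  \<comment> \<open>The terms are nonnegative, so summability of the inner sums over
    \<open>d\<close> gives summability over pairs, and the double sum is
    \<open>S * ?z\<close>.\<close>
  have "?f summable_on ?Q \<times> {0<..}"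
    by (rule summable_on_SigmaI[OF inner has_sum_imp_summable[OF outer]]) auto
  then have "(?f has_sum S * ?z) (?Q \<times> {0<..})"
    by (rule has_sum_SigmaI[OF inner outer])
  also have "?this \<longleftrightarrow> ((\<lambda>n. real n powr (- s)) has_sum S * ?z) {0<..}"
  proof (rule has_sum_reindex_bij_witness[of _ "\<lambda>n. (squarefree_part n, square_part n)" "\<lambda>(d, m). d * m\<^sup>2"])
    fix a assume "a \<in> ?Q \<times> {0::nat<..}"
    then obtain d m where [simp]: "a = (d, m)" and dm: "squarefree d" "m > 0" by auto
    have d: "d > 0" using dm by (intro Nat.gr0I) auto
    show "(case a of (d, m) \<Rightarrow> d * m\<^sup>2) \<in> {0<..}" using d dm by simp
    have sq: "square_part (d * m\<^sup>2) = m"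
      using dm by (rule square_part_squarefree_mult_square)
    then have "squarefree_part (d * m\<^sup>2) = d"
      using squarefree_decompose[of "d * m\<^sup>2"] dm by simp
    with sq show "(squarefree_part (case a of (d, m) \<Rightarrow> d * m\<^sup>2),
        square_part (case a of (d, m) \<Rightarrow> d * m\<^sup>2)) = a" by simp
    show "real (case a of (d, m) \<Rightarrow> d * m\<^sup>2) powr (- s) = ?f a"
    proof -
      have "real (m\<^sup>2) powr (- s) = real m powr (- s + - s)"
        by (simp add: power2_eq_square powr_mult flip: powr_add)
      then show ?thesis by (simp add: powr_mult)
    qed
  next
    fix n :: nat assume "n \<in> {0<..}"
    then show "(case (squarefree_part n, square_part n) of (d, m) \<Rightarrow> d * m\<^sup>2) = n"
      "(squarefree_part n, square_part n) \<in> ?Q \<times> {0<..}"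
      by (auto simp: squarefree_decompose[of n, symmetric] intro!: Nat.gr0I)
  qed simp
  finally have "S * ?z = riemann_zeta s"
    using has_sum_riemann_zeta[OF assms] has_sum_unique by blast
  then have "S = riemann_zeta s / ?z"
    using riemann_zeta_pos[of "2 * s"] assms by (simp add: field_simps)
  with S show ?thesis by simp
qed

theorem mainTheorem17:
  fixes s :: real
  assumes "s > 1"
  shows "limsup (\<lambda>n::nat. ereal (rho_s s n * sigma_s s n / real n powr (2 * s)))
         = ereal (riemann_zeta s / riemann_zeta (2 * s))"
proof -
  let ?C = "riemann_zeta s / riemann_zeta (2 * s)"
  note C = has_sum_squarefree_powr[OF assms]
  have "limsup (\<lambda>n. ereal (rho_sigma_quotient s n)) = ereal ?C"
  proof (rule antisym)
    have "rho_sigma_quotient s n \<le> ?C" if "n > 0" for n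
    proof -
      let ?r = "\<Prod>(prime_factors n)"
      have r: "squarefree ?r" by (rule squarefree_prod_primes) auto
      then have "?r > 0" by (intro Nat.gr0I notI) simp
      have "rho_sigma_quotient s n \<le> sigma_s (- s) ?r"
        using that assms by (rule rho_sigma_quotient_le_sigma_s)
      also have "\<dots> \<le> ?C"
        \<comment> \<open>All divisors of the squarefree \<open>?r\<close> are squarefree, so this
          is a finite partial sum of the series with value \<open>?C\<close>.\<close>
        unfolding sigma_s_def using r \<open>?r > 0\<close>
        by (intro finite_sum_le_has_sum[OF C]) (auto intro: squarefree_mono)
      finally show ?thesis .
    qed
    \<comment> \<open>The bound is only needed eventually, which discards the index 0.\<close>
    then show "limsup (\<lambda>n. ereal (rho_sigma_quotient s n)) \<le> ereal ?C"
      by (intro Limsup_bounded) (auto intro: eventually_mono[OF eventually_gt_at_top[of 0]])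
  next
    show "ereal ?C \<le> limsup (\<lambda>n. ereal (rho_sigma_quotient s n))"
      unfolding limsup_INF_SUP
    proof (intro INF_greatest, unfold le_SUP_iff, intro allI impI)
      fix n :: nat and y :: ereal
      assume "y < ereal ?C"
      \<comment> \<open>\<open>y\<close> may be minus infinity; a real \<open>c\<close> in between
        gives access to convergence of the real series.\<close>
      then obtain c where c: "y < ereal c" "c < ?C" using ereal_dense2 by fastforce
      obtain B where B: "finite B" "B \<subseteq> {d. squarefree d}" "c < (\<Sum>d\<in>B. real d powr (- s))"
        using order_tendstoD(1)[OF C[unfolded has_sum_def] c(2)]
        unfolding eventually_finite_subsets_at_top by blast
      obtain q where q: "prime q" "n < q" using bigger_prime by blast
      \<comment> \<open>The primes dividing members of \<open>B\<close> make every such member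
        divide the product of \<open>A\<close>; the extra prime \<open>q\<close> pushes that product
        beyond \<open>n\<close>.\<close>
      define A where "A = insert q (\<Union>d\<in>B. prime_factors d)"
      have A: "finite A" "\<And>p. p \<in> A \<Longrightarrow> prime p" using B(1) q(1) by (auto simp: A_def)
      have pos: "\<Prod>A > 0" using A(2) by (auto intro!: prod_pos simp: prime_gt_0_nat)
      have "q dvd \<Prod>A" using A(1) by (intro dvd_prodI) (auto simp: A_def)
      then have "q \<le> \<Prod>A" using pos by (rule dvd_imp_le)
      have "d dvd \<Prod>A" if "d \<in> B" for d
      proof -
        have "\<Prod>(prime_factors d) dvd \<Prod>A"
          using that A(1) by (intro prod_dvd_prod_subset) (auto simp: A_def)
        then show ?thesis using squarefree_eq_prod_prime_factors[of d] that B(2) by auto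
      qed
      then have "(\<Sum>d\<in>B. real d powr (- s)) \<le> sigma_s (- s) (\<Prod>A)"
        unfolding sigma_s_def using pos by (intro sum_mono2) auto
      also have "\<dots> = rho_sigma_quotient s (\<Prod>A)"
        using rho_sigma_quotient_prod_primes[OF A] by simp
      finally have "y < ereal (rho_sigma_quotient s (\<Prod>A))"
        using c(1) B(3) by (meson ereal_less_eq(3) less_le_trans order.strict_trans2 less_imp_le)
      then show "\<exists>i\<in>{n..}. y < ereal (rho_sigma_quotient s i)"
        using \<open>q \<le> \<Prod>A\<close> q(2) by (intro bexI[of _ "\<Prod>A"]) auto
    qed
  qed
  then show ?thesis by (simp add: rho_sigma_quotient_def)
qed

end
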